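(* Consider all configurations consisting of a triangle $ABC$ with $AB=AC$, a point $D$ in the interior of side $AC$ and a point $E$ in the interior of side $AB$. Put $a=\angle BAC$, $b=\angle DBC$, $c=\angle ECB$ and $\theta=\angle EDB$. Suppose that $a$, $b$, $c$ are each an integral number of degrees and that $b>c$. Then $\theta$ is a rational but non-integral number of degrees if and only if $(a,b,c)=(45^\circ,45^\circ,15^\circ)$, and in that case $\theta=7\tfrac12^\circ$.
   Context: All angles are ordinary (unsigned) angles of a Euclidean plane triangle configuration, measured in degrees. Since $D$ and $E$ are interior to the sides, $0<b,c<90^\circ-\tfrac{a}{2}$. Mirror images (exchanging the roles of $b$ and $c$) and the trivial cases $b=c$ are disregarded, which is expressed by the condition $b>c$. *)

theory Defs
  imports "HOL-Analysis.Analysis"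
begin

(* The unsigned angle XYZ at the vertex Y, in degrees, between 0 and 180.  By division by zero its
   value is 90 when X = Y or Z = Y, where no geometric angle exists. *)
definition angle_deg :: "real^2 \<Rightarrow> real^2 \<Rightarrow> real^2 \<Rightarrow> real" where
  "angle_deg X Y Z = arccos (((X - Y) \<bullet> (Z - Y)) / (norm (X - Y) * norm (Z - Y))) * 180 / pi"

end

theory Submission
  imports Defs "HOL-Computational_Algebra.Polynomial_Factorial"
begin

text \<open>
With angles in degrees, elementary trigonometry expresses \<open>\<theta>\<close> through
\<open>tan \<theta> = sin c (cos 2b + cos a) / (cos c (1 + cos a) - sin c sin 2b)\<close>.
For rational \<open>\<theta>\<close> this is a linear relation with integer coefficients between roots of unity, so it
survives multiplying all angles by any \<open>k\<close> prime to their common order.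
Multipliers \<open>k\<close> congruent to \<open>1\<close> modulo \<open>360\<close> fix \<open>a\<close>, \<open>b\<close>, \<open>c\<close> and hence \<open>tan \<theta>\<close>; this forces \<open>2\<theta>\<close>
to be an integer.  If \<open>\<theta>\<close> itself is not an integer, then comparing the relation with its image under
\<open>k = 181\<close> shows that \<open>a\<close> is odd and \<open>sin\<^sup>2 a = sin 2b sin 2c\<close>, that is
\<open>1 = cos 2a + cos 2(b - c) - cos 2(b + c)\<close>.  The multiplier \<open>91\<close> changes the sign of the cosines of
\<open>2n\<close> for odd \<open>n\<close> only, so \<open>cos 2a = 0\<close>, and then every conjugate of \<open>cos 2(b - c)\<close> is nonnegative.
This leaves \<open>b - c = 30\<close> and the single solution \<open>(45, 45, 15)\<close>.
\<close>

section \<open>Conjugates of roots of unity\<close>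

text \<open>Coefficients stay integral because the conjugation argument works modulo a prime in
  Z[z].\<close>

definition int_poly_eval :: "int poly \<Rightarrow> complex \<Rightarrow> complex" where
  "int_poly_eval f z = poly (map_poly of_int f) z"

lemma int_poly_eval_pCons [simp]:
  "int_poly_eval (pCons a f) z = of_int a + z * int_poly_eval f z"
  by (simp add: int_poly_eval_def map_poly_pCons)

lemma int_poly_eval_0 [simp]: "int_poly_eval 0 z = 0"
  by (simp add: int_poly_eval_def)

lemma int_poly_eval_1 [simp]: "int_poly_eval 1 z = 1"
  by (simp add: one_pCons)

lemma int_poly_eval_add [simp]: "int_poly_eval (f + g) z = int_poly_eval f z + int_poly_eval g z"
proof (induction f arbitrary: g)
  case (pCons a f)
  show ?case
    by (cases g) (simp add: pCons.IH ring_distribs)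
qed simp

lemma int_poly_eval_smult [simp]: "int_poly_eval (smult c f) z = of_int c * int_poly_eval f z"
  by (induction f) (simp_all add: algebra_simps)

lemma int_poly_eval_diff [simp]: "int_poly_eval (f - g) z = int_poly_eval f z - int_poly_eval g z"
  using int_poly_eval_add[of "f - g" g z] by (simp del: int_poly_eval_add)

lemma int_poly_eval_mult [simp]: "int_poly_eval (f * g) z = int_poly_eval f z * int_poly_eval g z"
  by (induction f) (simp_all add: algebra_simps)

lemma int_poly_eval_power [simp]: "int_poly_eval (f ^ n) z = int_poly_eval f z ^ n"
  by (induction n) simp_all

lemma int_poly_eval_monom [simp]: "int_poly_eval (monom c n) z = of_int c * z ^ n"
  by (induction n) (simp_all add: monom_0 monom_Suc)

section \<open>The Frobenius congruence modulo a prime\<close>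

text \<open>The inner binomial coefficients are divisible by p. The general ring lets the congruence
  serve both integers and integer polynomials.\<close>

lemma prime_power_add:
  fixes x y :: "'a::comm_ring_1"
  assumes "prime (p::nat)"
  shows "of_nat p dvd (x + y) ^ p - (x ^ p + y ^ p)"
proof -
  have p: "p > 0" using assms prime_gt_0_nat by blast
  have "(x + y) ^ p = (\<Sum>k\<le>p. of_nat (p choose k) * x ^ k * y ^ (p - k))"
    by (rule binomial_ring)
  also have "{..p} = insert 0 (insert p {0<..<p})" using p by auto
  also have "(\<Sum>k\<in>\<dots>. of_nat (p choose k) * x ^ k * y ^ (p - k)) =
      y ^ p + x ^ p + (\<Sum>k\<in>{0<..<p}. of_nat (p choose k) * x ^ k * y ^ (p - k))"
    using p by (simp add: add.assoc)
  finally have "(x + y) ^ p - (x ^ p + y ^ p) =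
      (\<Sum>k\<in>{0<..<p}. of_nat (p choose k) * x ^ k * y ^ (p - k))" by simp
  moreover have "of_nat p dvd (of_nat (p choose k) * x ^ k * y ^ (p - k) :: 'a)" if "k \<in> {0<..<p}" for k
  proof -
    have "p dvd (p choose k)" using assms that by (intro dvd_choose_prime) auto
    then have "(of_nat p :: 'a) dvd of_nat (p choose k)" by (auto elim!: dvdE)
    then show ?thesis by (simp add: dvd_mult2)
  qed
  ultimately show ?thesis by (auto intro!: dvd_sum)
qed

lemma prime_dvd_power_diff:
  assumes "prime (p::nat)"
  shows "int p dvd a ^ p - a"
proof (induction a rule: int_induct[where k = 0])
  case base
  show ?case using prime_gt_0_nat[OF assms] by (simp add: power_0_left)
next
  case (step1 i)
  then show ?case
    using dvd_add[OF prime_power_add[OF assms, of i 1] step1.IH] by (simp add: algebra_simps)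
next
  case (step2 i)
  then show ?case
    using dvd_diff[OF step2.IH prime_power_add[OF assms, of "i - 1" 1]] by (simp add: algebra_simps)
qed

text \<open>Induction over the coefficients: the binomial congruence splits off \<open>a\<close>,
  and Fermat's little theorem replaces \<open>a ^ p\<close> by \<open>a\<close>.\<close>

lemma int_poly_frobenius:
  assumes "prime (p::nat)"
  shows "\<exists>v. \<forall>z. int_poly_eval h z ^ p = int_poly_eval h (z ^ p) + of_nat p * int_poly_eval v z"
proof (induction h)
  case 0
  have "p > 0" using assms prime_gt_0_nat by blast
  then show ?case by (intro exI[of _ 0]) simp
next
  case (pCons a h)
  then obtain v where v: "\<And>z. int_poly_eval h z ^ p = int_poly_eval h (z ^ p) + of_nat p * int_poly_eval v z"
    by blast
  obtain w where w: "(pCons a h) ^ p - ([:a:] ^ p + (pCons 0 h) ^ p) = of_nat p * w"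
    using prime_power_add[OF assms, of "[:a:]" "pCons 0 h"] by (auto elim!: dvdE)
  obtain t where t: "a ^ p - a = int p * t"
    using prime_dvd_power_diff[OF assms] by (auto elim!: dvdE)
  show ?case
  proof (intro exI allI)
    fix z
    have "int_poly_eval ((pCons a h) ^ p - ([:a:] ^ p + (pCons 0 h) ^ p)) z = of_nat p * int_poly_eval w z"
      by (simp add: w of_nat_poly)
    then have "int_poly_eval (pCons a h) z ^ p =
        of_int (a ^ p) + (z * int_poly_eval h z) ^ p + of_nat p * int_poly_eval w z"
      by (simp add: algebra_simps)
    also have "a ^ p = a + int p * t" using t by simp
    also have "(z * int_poly_eval h z) ^ p = z ^ p * (int_poly_eval h (z ^ p) + of_nat p * int_poly_eval v z)"
      by (simp add: power_mult_distrib v)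
    finally show "int_poly_eval (pCons a h) z ^ p = int_poly_eval (pCons a h) (z ^ p) +
        of_nat p * int_poly_eval ([:t:] + monom 1 p * v + w) z"
      by (simp add: algebra_simps)
  qed
qed

section \<open>Minimal polynomials and conjugates of roots of unity\<close>

text \<open>Gauss's lemma for the minimal polynomial of z: the primitive part of a relation of least
  degree divides every relation over the fractions, hence over the integers because its content is
  1. It divides the monic X^N - 1, so its leading coefficient is a unit, and scaling by this unit
  makes it monic.\<close>

lemma int_relation_generator:
  assumes "N > 0" "z ^ N = 1"
  obtains g h where "monom 1 N - 1 = g * h" "lead_coeff g = 1" "int_poly_eval g z = 0"
    "\<And>f. int_poly_eval f z = 0 \<Longrightarrow> g dvd f"
proof -
  define X :: "int poly" where "X = monom 1 N - 1"
  have "coeff X N = 1" using assms(1) by (simp add: X_def)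
  then have X0: "X \<noteq> 0" by auto
  have Xz: "int_poly_eval X z = 0" using assms(2) by (simp add: X_def)
  have lcX: "lead_coeff X = 1"
  proof -
    have "degree X = N"
    proof (rule antisym)
      show "degree X \<le> N" unfolding X_def by (intro degree_diff_le) (simp_all add: degree_monom_le)
      show "N \<le> degree X" by (rule le_degree) (simp add: \<open>coeff X N = 1\<close>)
    qed
    then show ?thesis using \<open>coeff X N = 1\<close> by simp
  qed
  obtain g0 where g0: "g0 \<noteq> 0" "int_poly_eval g0 z = 0"
    and min: "\<And>f. f \<noteq> 0 \<Longrightarrow> int_poly_eval f z = 0 \<Longrightarrow> degree g0 \<le> degree f"
    using ex_has_least_nat[of "\<lambda>f. f \<noteq> 0 \<and> int_poly_eval f z = 0" X degree] X0 Xz by auto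
  define g1 where "g1 = primitive_part g0"
  have g0_eq: "g0 = smult (content g0) g1" by (simp add: g1_def)
  have g1: "g1 \<noteq> 0" "content g1 = 1" "degree g1 = degree g0"
    using g0(1) by (auto simp: g1_def)
  have g1z: "int_poly_eval g1 z = 0"
    using g0 arg_cong[OF g0_eq, of "\<lambda>f. int_poly_eval f z"] by simp
  have gen: "g1 dvd f" if f: "int_poly_eval f z = 0" for f
  proof -
    define r where "r = pseudo_mod f g1"
    obtain a q where aq: "a \<noteq> 0" "smult a f = g1 * q + r"
      and r: "r = 0 \<or> degree r < degree g1"
      using pseudo_mod[OF g1(1), of f] unfolding r_def by blast
    have "int_poly_eval r z = 0"
      using arg_cong[OF aq(2), of "\<lambda>f. int_poly_eval f z"] by (simp add: f g1z)
    then have "r = 0" using r min[of r] g1(3) by (metis not_le)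
    then have "fract_poly g1 dvd fract_poly (smult a f)"
      using aq(2) by (simp only: add_0_right fract_poly_mult dvd_triv_left)
    then have "fract_poly g1 dvd fract_poly f"
      using aq(1) by (simp add: dvd_smult_iff)
    then show ?thesis using g1(2) by (rule fract_poly_dvdD)
  qed
  obtain h where h: "X = g1 * h" using gen[OF Xz] by (auto elim!: dvdE)
  have e: "lead_coeff g1 * lead_coeff h = 1" using lcX by (simp add: h lead_coeff_mult)
  define e where "e = lead_coeff g1"
  have ee: "e * e = 1"
    using e zmult_eq_1_iff[of e] by (auto simp: e_def)
  show thesis
  proof (rule that)
    show "monom 1 N - 1 = smult e g1 * smult e h" using ee by (simp add: h flip: X_def)
    show "lead_coeff (smult e g1) = 1" using ee g1(1) by (simp add: e_def)
    show "int_poly_eval (smult e g1) z = 0" by (simp add: g1z)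
    show "smult e g1 dvd f" if "int_poly_eval f z = 0" for f
    proof -
      have "smult e (smult e g1) dvd f" using gen[OF that] ee by simp
      then show ?thesis by (metis dvd_trans dvd_smult dvd_refl)
    qed
  qed
qed

lemma root_of_unity_conjugate_prime:
  assumes N: "N > 0" "z ^ N = 1" and p: "prime (p::nat)" "\<not> p dvd N"
    and f: "int_poly_eval f z = 0"
  shows "int_poly_eval f (z ^ p) = 0"
proof -
  obtain g h where gh: "monom 1 N - 1 = g * h" and lc: "lead_coeff g = 1" and gz: "int_poly_eval g z = 0"
    and gen: "\<And>f. int_poly_eval f z = 0 \<Longrightarrow> g dvd f"
    using int_relation_generator[OF N] by metis
  \<comment> \<open>Otherwise \<open>h(z\<^sup>p) = 0\<close>, so \<open>p\<close> divides \<open>h(z)\<^sup>p\<close> in \<open>\<int>[z]\<close>.  Differentiating \<open>X\<^sup>N - 1 = g h\<close> at \<open>z\<close> makes \<open>h(z)\<close>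
     a divisor of \<open>N\<close>, so \<open>p\<close> divides \<open>N\<^sup>p\<close> and hence \<open>1\<close> in \<open>\<int>[z]\<close>, which monicity of \<open>g\<close> excludes.\<close>
  have "int_poly_eval g (z ^ p) = 0"
  proof (rule ccontr)
    assume ne: "int_poly_eval g (z ^ p) \<noteq> 0"
    have "int_poly_eval (monom 1 N - 1) (z ^ p) = 0"
      using N by (simp flip: power_mult add: mult.commute[of p]) (simp add: power_mult)
    then have hz: "int_poly_eval h (z ^ p) = 0" using ne by (simp add: gh)
    obtain v where v: "\<And>x. int_poly_eval h x ^ p = int_poly_eval h (x ^ p) + of_nat p * int_poly_eval v x"
      using int_poly_frobenius[OF p(1)] by blast
    have "int_poly_eval (pderiv (monom 1 N - 1)) z = int_poly_eval (pderiv g) z * int_poly_eval h z"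
      by (simp add: gh pderiv_mult gz)
    then have d: "of_nat N * z ^ (N - 1) = int_poly_eval (pderiv g) z * int_poly_eval h z"
      by (simp add: pderiv_diff pderiv_monom)
    have "of_nat N = of_nat N * z ^ (N - 1) * z"
      using N by (metis Suc_diff_1 mult.assoc mult.right_neutral power_Suc2)
    then have "of_nat N = int_poly_eval (pderiv g) z * z * int_poly_eval h z"
      unfolding d by (simp add: mult_ac)
    then have "of_nat N ^ p = (int_poly_eval (pderiv g) z * z) ^ p * int_poly_eval h z ^ p"
      by (simp add: power_mult_distrib)
    then have Np: "of_nat N ^ p = of_nat p * int_poly_eval ((pderiv g * monom 1 1) ^ p * v) z"
      by (simp add: v hz mult_ac power_mult_distrib)
    have "coprime (int N ^ p) (int p)"
      using prime_imp_coprime[OF p] by (simp add: coprime_commute)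
    then obtain s t where st: "s * int N ^ p + t * int p = 1"
      using bezout_int[of "int N ^ p" "int p"] by (auto simp: coprime_iff_gcd_eq_1)
    define q where "q = smult s ((pderiv g * monom 1 1) ^ p * v) + [:t:]"
    have "of_int (s * int N ^ p + t * int p) = (of_nat p * int_poly_eval q z :: complex)"
      by (simp add: q_def Np algebra_simps)
    then have "of_nat p * int_poly_eval q z = 1" by (simp add: st)
    moreover define r where "r = pseudo_mod q g"
    have g0: "g \<noteq> 0" using lc by auto
    \<comment> \<open>As g is monic, the multiplier in pseudo-division is 1 and r is a genuine
      remainder over the integers.\<close>
    obtain u where u: "q = g * u + r"
      using pseudo_divmod(1)[OF g0 prod.collapse[symmetric], of q] lc by (simp add: r_def pseudo_mod_def)
    ultimately have "int_poly_eval (smult (int p) r - 1) z = 0" by (simp add: u gz)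
    then have "g dvd smult (int p) r - 1" by (rule gen)
    moreover have "degree g > 0"
    proof (rule ccontr)
      assume "\<not> degree g > 0"
      then obtain c where "g = [:c:]" by (auto elim: degree_eq_zeroE)
      then show False using lc gz by simp
    qed
    moreover have "degree (smult (int p) r - 1) < degree g"
    proof -
      have "degree r < degree g"
        using pseudo_mod(2)[OF g0, of q] \<open>degree g > 0\<close> unfolding r_def by auto
      then show ?thesis
        using \<open>degree g > 0\<close> by (intro degree_diff_less) (auto intro: le_less_trans[OF degree_smult_le])
    qed
    \<comment> \<open>A multiple of g of smaller degree than g vanishes; its constant term then
      makes p a divisor of 1.\<close>
    ultimately have "smult (int p) r - 1 = 0"
      using dvd_imp_degree_le[of g "smult (int p) r - 1"] by fastforce
    then have "coeff (smult (int p) r) 0 = coeff 1 0" by simp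
    then have "int p * coeff r 0 = 1" by simp
    then have "int p dvd 1" by (metis dvd_triv_left)
    then show False using p by (simp add: prime_nat_iff)
  qed
  then show ?thesis using gen[OF f] by (auto elim!: dvdE)
qed

text \<open>Prime factors p of k are peeled off one by one: z^p is again an N-th root of unity that
  satisfies the relation.\<close>

lemma root_of_unity_conjugate:
  assumes "N > 0" "z ^ N = 1" "coprime k N" "k > 0" "int_poly_eval f z = 0"
  shows "int_poly_eval f (z ^ k) = 0"
  using assms
proof (induction k arbitrary: z rule: prime_divisors_induct)
  case (factor p k)
  have "int_poly_eval f (z ^ p) = 0"
    using factor by (intro root_of_unity_conjugate_prime[of N]) (auto dest: coprime_common_divisor_nat)
  moreover have "(z ^ p) ^ N = 1"
    using factor.prems by (metis mult.commute power_mult power_one)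
  ultimately have "int_poly_eval f ((z ^ p) ^ k) = 0"
    using factor by (intro factor.IH) auto
  then show ?case by (simp add: power_mult)
qed auto

text \<open>The sum is the value at z = cis (2 pi / N) of an integer polynomial whose exponents are
  the e reduced modulo N, which also admits negative e. Replacing z by z^k multiplies every angle by
  k.\<close>

lemma cis_relation_conjugate:
  fixes xs :: "(int \<times> int) list"
  assumes N: "N > 0" and k: "coprime k N" "k > 0"
    and rel: "(\<Sum>(m, e)\<leftarrow>xs. of_int m * cis (2 * pi * of_int e / of_nat N)) = 0"
  shows "(\<Sum>(m, e)\<leftarrow>xs. of_int m * cis (of_nat k * (2 * pi * of_int e / of_nat N))) = 0"
proof -
  define z where "z = cis (2 * pi / of_nat N)"
  define f where "f = (\<Sum>(m, e)\<leftarrow>xs. monom m (nat (e mod int N)))"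
  have "cis (of_nat N * (2 * pi / of_nat N)) = 1" using N by simp
  then have zN: "z ^ N = 1" unfolding z_def Complex.DeMoivre .
  have pow: "(z ^ l) ^ nat (e mod int N) = cis (of_nat l * (2 * pi * of_int e / of_nat N))" for l e
  proof -
    have "real_of_int e = of_int (int N * (e div int N) + int (nat (e mod int N)))"
      using N by simp
    then have "real_of_int e = of_nat N * of_int (e div int N) + of_nat (nat (e mod int N))"
      by (simp only: of_int_add of_int_mult of_int_of_nat_eq)
    then have "of_nat l * (2 * pi * of_int e / of_nat N) =
        of_nat l * (of_nat (nat (e mod int N)) * (2 * pi / of_nat N)) + 2 * pi * of_int (of_nat l * (e div int N))"
      using N by (simp add: field_simps)
    then have "cis (of_nat l * (2 * pi * of_int e / of_nat N)) =
        cis (of_nat (nat (e mod int N)) * (of_nat l * (2 * pi / of_nat N))) * cis (2 * pi * of_int (of_nat l * (e div int N)))"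
      by (simp only: cis_mult mult.left_commute)
    also have "cis (2 * pi * of_int (of_nat l * (e div int N))) = 1"
      by (rule cis_multiple_2pi) (rule Ints_of_int)
    finally show ?thesis by (simp only: z_def Complex.DeMoivre mult_1_right)
  qed
  have ev: "int_poly_eval f (z ^ l) = (\<Sum>(m, e)\<leftarrow>xs. of_int m * cis (of_nat l * (2 * pi * of_int e / of_nat N)))" for l
    unfolding f_def by (induction xs) (auto simp: pow)
  have "int_poly_eval f z = 0" using ev[of 1] rel by simp
  from root_of_unity_conjugate[OF N zN k this] show ?thesis by (simp add: ev)
qed

section \<open>Conjugation of trigonometric relations in degrees\<close>

definition rad :: "real \<Rightarrow> real" where
  "rad x = x * pi / 180"

lemma rad_simps:
  "rad (x + y) = rad x + rad y" "rad (x - y) = rad x - rad y" "rad (- x) = - rad x"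
  "rad (2 * x) = 2 * rad x" "rad 0 = 0"
  by (simp_all add: rad_def field_simps)

lemma rad_less_iff: "rad x < rad y \<longleftrightarrow> x < y"
  by (simp add: rad_def field_simps)

text \<open>Here q is a common denominator of the angles in degrees, so each
  \<open>cis (rad x)\<close> is a (360 q)-th root of unity.\<close>

lemma cis_rad_conjugate:
  fixes xs :: "(int \<times> real) list"
  assumes q: "q > 0" and k: "coprime k (360 * q)" "k > 0"
    and int: "\<And>m x. (m, x) \<in> set xs \<Longrightarrow> of_nat q * x \<in> \<int>"
    and rel: "(\<Sum>(m, x)\<leftarrow>xs. of_int m * cis (rad x)) = 0"
  shows "(\<Sum>(m, x)\<leftarrow>xs. of_int m * cis (rad (of_nat k * x))) = 0"
proof -
  define ys where "ys = map (\<lambda>(m, x). (m, \<lfloor>of_nat q * x\<rfloor>)) xs"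
  have "(\<Sum>(m, e)\<leftarrow>ys. of_int m * cis (of_nat l * (2 * pi * of_int e / of_nat (360 * q)))) =
      (\<Sum>(m, x)\<leftarrow>xs. of_int m * cis (rad (of_nat l * x)))" for l
    unfolding ys_def map_map
  proof (rule arg_cong[where f = sum_list], rule map_cong[OF refl])
    fix p assume "p \<in> set xs"
    obtain m x where p: "p = (m, x)" by force
    have fl: "of_int \<lfloor>of_nat q * x\<rfloor> = of_nat q * x"
      using int \<open>p \<in> set xs\<close> unfolding p by (metis Ints_cases floor_of_int)
    have "of_nat l * (2 * pi * of_int \<lfloor>of_nat q * x\<rfloor> / of_nat (360 * q)) = rad (of_nat l * x)"
      unfolding fl using q by (simp add: rad_def field_simps)
    then show "((\<lambda>(m, e). of_int m * cis (of_nat l * (2 * pi * of_int e / of_nat (360 * q)))) \<circ>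
        (\<lambda>(m, x). (m, \<lfloor>of_nat q * x\<rfloor>))) p = (case p of (m, x) \<Rightarrow> of_int m * cis (rad (of_nat l * x)))"
      by (simp only: p comp_def prod.case)
  qed
  from this[of 1] this[of k] show ?thesis
    using cis_relation_conjugate[OF _ k, of ys] q rel by simp
qed

lemma cis_minus_cis: "cis x - cis (- x) = 2 * \<i> * of_real (sin x)"
  by (simp add: complex_eq_iff)

lemma cis_plus_cis: "cis x + cis (- x) = 2 * of_real (cos x)"
  by (simp add: complex_eq_iff)

text \<open>Multiplication by 2 i turns each sine into cis x - cis (-x), so the coefficients stay
  integral; the factor 2 i remains outside the sum and is itself never conjugated.\<close>

lemma sin_rad_conjugate:
  fixes xs :: "(int \<times> real) list"
  assumes q: "q > 0" and k: "coprime k (360 * q)" "k > 0"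
    and int: "\<And>m x. (m, x) \<in> set xs \<Longrightarrow> of_nat q * x \<in> \<int>"
    and rel: "(\<Sum>(m, x)\<leftarrow>xs. of_int m * sin (rad x)) = 0"
  shows "(\<Sum>(m, x)\<leftarrow>xs. of_int m * sin (rad (of_nat k * x))) = 0"
proof -
  define ys where "ys = xs @ map (\<lambda>(m, x). (- m, - x)) xs"
  have ys: "(\<Sum>(m, x)\<leftarrow>ys. of_int m * cis (rad (of_nat l * x))) =
      2 * \<i> * of_real (\<Sum>(m, x)\<leftarrow>xs. of_int m * sin (rad (of_nat l * x)))" for l
    unfolding ys_def
  proof (induction xs)
    case (Cons p xs)
    obtain m x where p: "p = (m, x)" by force
    show ?case
      using Cons cis_minus_cis[of "rad (of_nat l * x)"]
      by (simp add: p rad_simps algebra_simps)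
  qed simp
  have "(\<Sum>(m, x)\<leftarrow>ys. of_int m * cis (rad (of_nat k * x))) = 0"
  proof (rule cis_rad_conjugate[OF q k])
    show "of_nat q * x \<in> \<int>" if "(m, x) \<in> set ys" for m x
      using that int by (auto simp: ys_def)
    show "(\<Sum>(m, x)\<leftarrow>ys. of_int m * cis (rad x)) = 0"
      using ys[of 1] rel by simp
  qed
  then show ?thesis by (simp add: ys)
qed

lemma cos_rad_conjugate:
  fixes xs :: "(int \<times> real) list"
  assumes q: "q > 0" and k: "coprime k (360 * q)" "k > 0"
    and int: "\<And>m x. (m, x) \<in> set xs \<Longrightarrow> of_nat q * x \<in> \<int>"
    and rel: "(\<Sum>(m, x)\<leftarrow>xs. of_int m * cos (rad x)) = 0"
  shows "(\<Sum>(m, x)\<leftarrow>xs. of_int m * cos (rad (of_nat k * x))) = 0"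
proof -
  define ys where "ys = xs @ map (\<lambda>(m, x). (m, - x)) xs"
  have ys: "(\<Sum>(m, x)\<leftarrow>ys. of_int m * cis (rad (of_nat l * x))) =
      2 * of_real (\<Sum>(m, x)\<leftarrow>xs. of_int m * cos (rad (of_nat l * x)))" for l
    unfolding ys_def
  proof (induction xs)
    case (Cons p xs)
    obtain m x where p: "p = (m, x)" by force
    show ?case
      using Cons arg_cong[OF cis_plus_cis, of "\<lambda>y. of_int m * y" "rad (of_nat l * x)"]
      by (simp add: p rad_simps algebra_simps)
  qed simp
  have "(\<Sum>(m, x)\<leftarrow>ys. of_int m * cis (rad (of_nat k * x))) = 0"
  proof (rule cis_rad_conjugate[OF q k])
    show "of_nat q * x \<in> \<int>" if "(m, x) \<in> set ys" for m x
      using that int by (auto simp: ys_def)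
    show "(\<Sum>(m, x)\<leftarrow>ys. of_int m * cis (rad x)) = 0"
      using ys[of 1] rel by simp
  qed
  then show ?thesis by (simp add: ys)
qed

section \<open>The trigonometric relation and its conjugates\<close>

text \<open>The formula for tan \<theta> with denominators cleared, so that it also makes sense when
  cos \<theta> vanishes.\<close>

definition angle_relation :: "real \<Rightarrow> real \<Rightarrow> real \<Rightarrow> real \<Rightarrow> bool" where
  "angle_relation \<theta> a b c \<longleftrightarrow>
     sin (rad \<theta>) * (cos (rad c) * (1 + cos (rad a)) - sin (rad c) * sin (rad (2 * b))) =
     cos (rad \<theta>) * (sin (rad c) * (cos (rad (2 * b)) + cos (rad a)))"

text \<open>The products of three factors group into cos a sin (\<theta> - c) and sin c cos (2b -
  \<theta>), so doubling and product-to-sum leave only the coefficients 1 and -1. This is the linear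
  form that can be conjugated.\<close>

lemma angle_relation_sines:
  "angle_relation \<theta> a b c \<longleftrightarrow>
    (\<Sum>(m, x)\<leftarrow>[(1, \<theta> - c), (1, \<theta> + c), (1, a - c + \<theta>), (- 1, c + 2 * b - \<theta>), (- 1, c + \<theta> - 2 * b),
        (- 1, a + c - \<theta>)]. of_int m * sin (rad x)) = 0"
proof -
  have "(\<Sum>(m, x)\<leftarrow>[(1, \<theta> - c), (1, \<theta> + c), (1, a - c + \<theta>), (- 1, c + 2 * b - \<theta>), (- 1, c + \<theta> - 2 * b),
        (- 1, a + c - \<theta>)]. of_int m * sin (rad x)) =
      2 * (sin (rad \<theta>) * (cos (rad c) * (1 + cos (rad a)) - sin (rad c) * sin (rad (2 * b))) -
        cos (rad \<theta>) * (sin (rad c) * (cos (rad (2 * b)) + cos (rad a))))"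
    by (simp add: rad_simps(1-3) sin_add sin_diff cos_add cos_diff algebra_simps)
  then show ?thesis unfolding angle_relation_def by simp
qed

lemma angle_relation_conjugate:
  fixes a b c :: int and k :: nat and \<theta> :: real
  assumes "angle_relation \<theta> a b c" "q > 0" "of_nat q * \<theta> \<in> \<int>" "coprime k (360 * q)" "k > 0"
  shows "angle_relation (k * \<theta>) (k * a) (k * b) (k * c)"
proof -
  have i: "of_nat q * of_int n \<in> (\<int> :: real set)" "of_nat q * (2 * of_int n) \<in> (\<int> :: real set)" for n
    by simp_all
  define xs :: "(int \<times> real) list" where
    "xs = [(1, \<theta> - c), (1, \<theta> + c), (1, a - c + \<theta>), (- 1, c + 2 * b - \<theta>), (- 1, c + \<theta> - 2 * b),
      (- 1, a + c - \<theta>)]"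
  have "(\<Sum>(m, x)\<leftarrow>xs. of_int m * sin (rad (of_nat k * x))) = 0"
  proof (rule sin_rad_conjugate[OF assms(2,4,5)])
    show "of_nat q * x \<in> \<int>" if "(m, x) \<in> set xs" for m x
      using that assms(3) by (auto simp: xs_def distrib_left right_diff_distrib intro!: Ints_add Ints_diff i)
    show "(\<Sum>(m, x)\<leftarrow>xs. of_int m * sin (rad x)) = 0"
      using assms(1) unfolding angle_relation_sines xs_def
      by (simp only: of_int_add of_int_diff of_int_mult of_int_numeral)
  qed
  then show ?thesis
    unfolding angle_relation_sines xs_def by (simp add: algebra_simps)
qed

lemma sin_rad_add_180: "sin (rad (x + 180 * of_int n)) = (if even n then sin (rad x) else - sin (rad x))"
  and cos_rad_add_180: "cos (rad (x + 180 * of_int n)) = (if even n then cos (rad x) else - cos (rad x))"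
proof -
  have "rad (x + 180 * of_int n) = rad x + of_int n * pi" by (simp add: rad_def field_simps)
  then show "sin (rad (x + 180 * of_int n)) = (if even n then sin (rad x) else - sin (rad x))"
    and "cos (rad (x + 180 * of_int n)) = (if even n then cos (rad x) else - cos (rad x))"
    by (simp_all add: sin_add cos_add sin_zero_iff_int2 mult.commute[of _ pi] cos_npi_int)
qed

section \<open>A rational \<theta> is an integer or half an odd integer\<close>

lemma exists_unit_multiplier:
  assumes "q > 0" "\<not> q dvd (2 :: nat)"
  obtains j where "coprime (1 + 360 * j) q" "\<not> q dvd 2 * j"
  \<comment> \<open>The prime 19 is special because \<open>1 + 360 = 19\<^sup>2\<close>.\<close>
proof (cases "19 dvd q")
  case False
  have "prime (19 :: nat)" by (simp add: prime_nat_numeral_eq)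
  then have "coprime ((19 :: nat) ^ 2) q"
    using prime_imp_coprime[OF _ False] unfolding coprime_power_left_iff by blast
  then show thesis using that[of 1] assms(2) by simp
next
  case True
  have p: "prime (19 :: nat)" by (simp add: prime_nat_numeral_eq)
  obtain r where q: "q = 19 ^ multiplicity 19 q * r" and r: "\<not> 19 dvd r"
    by (rule multiplicity_decompose'[of q 19]) (use assms(1) in auto)
  \<comment> \<open>A multiple j of r makes 1 + 360 j prime to r. As 360 is -1 modulo 19, the last
    condition says that j is not 1 modulo 19: take j = r, or j = 2 r when r is 1 modulo 19.\<close>
  obtain j where j: "r dvd j" "\<not> 19 dvd 2 * j" "\<not> 19 dvd 1 + 360 * j"
  proof (cases "r mod 19 = 1")
    case True
    define m where "m = r div 19"
    have "r = 19 * m + 1" using mult_div_mod_eq[of 19 r] True by (simp add: m_def)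
    then have "2 * (2 * r) = 4 + 19 * (4 * m)" "1 + 360 * (2 * r) = 18 + 19 * (37 + 720 * m)" by simp_all
    then have "2 * (2 * r) mod 19 = 4" "(1 + 360 * (2 * r)) mod 19 = 18"
      by (simp_all only: mod_mult_self2) simp_all
    then show ?thesis using that[of "2 * r"] by (simp add: dvd_eq_mod_eq_0)
  next
    case False
    have "r > 0" using r by (cases "r = 0") auto
    have "\<not> 19 dvd 2 * r" using r prime_dvd_mult_iff[OF p, of 2 r] by simp
    moreover have "\<not> 19 dvd 1 + 360 * r"
    proof
      assume "19 dvd 1 + 360 * r"
      then have "19 dvd 19 * (19 * r) - (1 + 360 * r)" by (intro dvd_diff_nat dvd_triv_left)
      also have "19 * (19 * r) - (1 + 360 * r) = r - 1" by simp
      finally obtain m where "r - 1 = 19 * m" by blast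
      then have "r = 1 + 19 * m" using \<open>r > 0\<close> by simp
      then have "r mod 19 = 1 mod 19" by (simp only: mod_mult_self2)
      then show False using False by simp
    qed
    ultimately show ?thesis using that[of r] by simp
  qed
  have "coprime (1 + 360 * j) (19 ^ multiplicity 19 q)"
    using prime_imp_coprime[OF p j(3)] by (simp add: coprime_commute)
  moreover have "coprime (1 + 360 * j) r"
  proof (rule coprimeI)
    fix d assume "d dvd 1 + 360 * j" "d dvd r"
    then show "is_unit d" using j(1) by (metis dvd_add_left_iff dvd_mult dvd_trans)
  qed
  ultimately have "coprime (1 + 360 * j) q" by (subst q) simp
  moreover have "\<not> q dvd 2 * j" using True j(2) by (meson dvd_trans)
  ultimately show thesis using that by blast
qed

text \<open>The unit vectors (cos \<theta>, sin \<theta>) and (cos \<phi>, sin \<phi>) are both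
  parallel to the nonzero vector (Q, P), so their determinant sin (\<theta> - \<phi>)
  vanishes.\<close>

lemma angle_relation_determines:
  assumes "angle_relation \<theta> a b c" "angle_relation \<phi> a b c" "sin (rad c) * (cos (rad (2 * b)) + cos (rad a)) \<noteq> 0"
  shows "sin (rad (\<theta> - \<phi>)) = 0"
proof -
  define P Q where "P = sin (rad c) * (cos (rad (2 * b)) + cos (rad a))"
    and "Q = cos (rad c) * (1 + cos (rad a)) - sin (rad c) * sin (rad (2 * b))"
  have "sin (rad \<theta>) * Q = cos (rad \<theta>) * P" "sin (rad \<phi>) * Q = cos (rad \<phi>) * P"
    using assms(1,2) by (simp_all add: angle_relation_def P_def Q_def)
  then have "P * (sin (rad \<theta>) * cos (rad \<phi>) - cos (rad \<theta>) * sin (rad \<phi>)) = 0"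
    by algebra
  then show ?thesis using assms(3) by (simp add: P_def rad_simps(2) sin_diff)
qed

lemma sin_rad_eq_0: "sin (rad x) = 0 \<longleftrightarrow> (\<exists>n::int. x = 180 * of_int n)"
  by (auto simp: sin_zero_iff_int2 rad_def)

lemma sin_rad_add_360: "sin (rad (x + 360 * of_int n)) = sin (rad x)"
  and cos_rad_add_360: "cos (rad (x + 360 * of_int n)) = cos (rad x)"
  using sin_rad_add_180[of x "2 * n"] cos_rad_add_180[of x "2 * n"] by simp_all

lemma angle_relation_shift:
  "angle_relation \<theta> (a + 360 * of_int i) (b + 360 * of_int j) (c + 360 * of_int k) \<longleftrightarrow> angle_relation \<theta> a b c"
proof -
  have "2 * (b + 360 * of_int j) = 2 * b + 360 * of_int (2 * j)" by simp
  then show ?thesis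
    unfolding angle_relation_def by (simp only: sin_rad_add_360 cos_rad_add_360)
qed

text \<open>Let q be the reduced denominator of \<theta>. The multiplier 1 + 360 j fixes a, b, c
  modulo 360, so 360 j \<theta> is a multiple of 180 and q divides 2 j; if q did not divide 2, some
  admissible j would violate this.\<close>

lemma angle_relation_half_integer:
  fixes a b c :: int
  assumes rel: "angle_relation \<theta> a b c" and "\<theta> \<in> \<rat>"
    and nz: "sin (rad c) * (cos (rad (2 * of_int b)) + cos (rad a)) \<noteq> 0"
  shows "2 * \<theta> \<in> \<int>"
proof -
  obtain p' :: int and q' :: int where pq': "q' > 0" "coprime p' q'" "\<theta> = of_int p' / of_int q'"
    using assms(2) by (rule Rats_cases')
  define q where "q = nat q'"
  have q: "q > 0" "coprime p' (int q)" "\<theta> = of_int p' / of_nat q"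
    using pq' by (simp_all add: q_def)
  have "q dvd 2"
  proof (rule ccontr)
    assume "\<not> q dvd 2"
    then obtain j where j: "coprime (1 + 360 * j) q" "\<not> q dvd 2 * j"
      using exists_unit_multiplier q(1) by metis
    have "coprime (1 + 360 * j) 360"
    proof (rule coprimeI)
      fix d assume "d dvd 1 + 360 * j" "d dvd 360"
      then show "is_unit d" using dvd_add_left_iff[of d "360 * j" 1] by (simp add: dvd_mult2)
    qed
    then have cop: "coprime (1 + 360 * j) (360 * q)" using j(1) by simp
    have "angle_relation (real (1 + 360 * j) * \<theta>) (int (1 + 360 * j) * a) (int (1 + 360 * j) * b) (int (1 + 360 * j) * c)"
      using rel q cop by (intro angle_relation_conjugate[of _ _ _ _ q]) auto
    then have "angle_relation (real (1 + 360 * j) * \<theta>) a b c"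
      using angle_relation_shift[of "real (1 + 360 * j) * \<theta>" a "int j * a" b "int j * b" c "int j * c"]
      by (simp add: algebra_simps)
    from angle_relation_determines[OF this rel nz]
    obtain n :: int where "real (1 + 360 * j) * \<theta> - \<theta> = 180 * of_int n"
      by (auto simp: sin_rad_eq_0)
    then have "2 * real j * \<theta> = of_int n" by (simp add: algebra_simps)
    then have "real_of_int (2 * int j * p') = of_int (n * int q)" using q(1,3) by (simp add: field_simps)
    then have "2 * int j * p' = n * int q" by (simp only: of_int_eq_iff)
    then have "int q dvd 2 * int j * p'" by simp
    then have "int q dvd 2 * int j" using q(2) by (simp add: coprime_dvd_mult_left_iff coprime_commute)
    then have "q dvd 2 * j" by (metis of_nat_dvd_iff of_nat_mult of_nat_numeral)
    then show False using j(2) by simp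
  qed
  then obtain l where "2 = q * l" by blast
  then have "real q * real l = 2" by (metis of_nat_mult of_nat_numeral)
  moreover have "of_nat q * \<theta> = of_int p'" using q by simp
  ultimately have "2 * \<theta> = of_int (int l * p')" by (simp add: mult_ac flip: \<open>real q * real l = 2\<close>)
  then show ?thesis by (metis Ints_of_int)
qed

text \<open>For \<theta> = n + 1/2, the multiplier 181 turns \<theta> into \<theta> + 90 + 180 n and
  adds 180 x to each integral angle x. This exchanges sine and cosine of \<theta> up to sign, and
  the two relations together eliminate \<theta>.\<close>

lemma angle_relation_proper_half:
  fixes a b c :: int
  assumes rel: "angle_relation \<theta> a b c" and "2 * \<theta> \<in> \<int>" "\<theta> \<notin> \<int>"
    and nz: "sin (rad c) * (cos (rad (2 * of_int b)) + cos (rad a)) \<noteq> 0"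
  shows "odd a" "(cos (rad a))\<^sup>2 = 1 - sin (rad (2 * of_int b)) * sin (rad (2 * of_int c))"
proof -
  obtain m :: int where m: "2 * \<theta> = of_int m" using assms(2) by (auto elim: Ints_cases)
  have "odd m"
  proof
    assume "even m"
    then obtain l where "m = 2 * l" by blast
    then have "\<theta> = of_int l" using m by simp
    then show False using assms(3) by simp
  qed
  then obtain n where n: "m = 2 * n + 1" by (elim oddE)
  have "angle_relation (real 181 * \<theta>) (int 181 * a) (int 181 * b) (int 181 * c)"
  proof (rule angle_relation_conjugate[OF rel])
    show "coprime (181::nat) (360 * 2)" by code_simp
  qed (use m in auto)
  \<comment> \<open>The zero shifts \<open>360 * of_int 0\<close> only bring the angles into the
    form that \<open>angle_relation_shift\<close> rewrites.\<close>
  moreover have "real_of_int (int 181 * a) = (of_int a + 180 * of_int a) + 360 * of_int 0"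
    "real_of_int (int 181 * c) = (of_int c + 180 * of_int c) + 360 * of_int 0"
    "real_of_int (int 181 * b) = (of_int b + 180 * of_int b) + 360 * of_int 0"
    "real 181 * \<theta> = (90 + \<theta>) + 180 * of_int n"
    using m n by simp_all
  ultimately have "angle_relation ((90 + \<theta>) + 180 * of_int n)
      (of_int a + 180 * of_int a) (of_int b + 180 * of_int b) (of_int c + 180 * of_int c)"
    by (simp only: angle_relation_shift)
  moreover have "2 * (real_of_int b + 180 * of_int b) = 2 * of_int b + 360 * of_int b" by simp
  ultimately have rel': "angle_relation ((90 + \<theta>) + 180 * of_int n) (of_int a + 180 * of_int a) b (of_int c + 180 * of_int c)"
    unfolding angle_relation_def by (simp only: cos_rad_add_360 sin_rad_add_360)
  have shift: "sin (rad (90 + \<theta>)) = cos (rad \<theta>)" "cos (rad (90 + \<theta>)) = - sin (rad \<theta>)"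
    by (simp_all add: rad_def add_divide_distrib distrib_right sin_add cos_add)
  define A where "A = (if even a then cos (rad a) else - cos (rad a))"
  \<comment> \<open>For odd c, sin c and cos c change sign together, which cancels between the two
    sides; so does the sign from 180 n. Only cos a can change sign effectively.\<close>
  have rel2: "cos (rad \<theta>) * (cos (rad c) * (1 + A) - sin (rad c) * sin (rad (2 * of_int b))) =
      - sin (rad \<theta>) * (sin (rad c) * (cos (rad (2 * of_int b)) + A))"
    using rel' unfolding angle_relation_def sin_rad_add_180 cos_rad_add_180 shift A_def
    by (auto split: if_splits simp: algebra_simps)
  have rel1: "sin (rad \<theta>) * (cos (rad c) * (1 + cos (rad a)) - sin (rad c) * sin (rad (2 * of_int b))) =
     cos (rad \<theta>) * (sin (rad c) * (cos (rad (2 * of_int b)) + cos (rad a)))"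
    using rel unfolding angle_relation_def .
  have t: "(sin (rad \<theta>))\<^sup>2 + (cos (rad \<theta>))\<^sup>2 = 1" by simp
  show "odd a"
  proof
    assume "even a"
    then have "A = cos (rad a)" by (simp add: A_def)
    define P Q where "P = sin (rad c) * (cos (rad (2 * of_int b)) + cos (rad a))"
      and "Q = cos (rad c) * (1 + cos (rad a)) - sin (rad c) * sin (rad (2 * of_int b))"
    have "sin (rad \<theta>) * Q = cos (rad \<theta>) * P" "cos (rad \<theta>) * Q = - sin (rad \<theta>) * P"
      using rel1 rel2 unfolding \<open>A = cos (rad a)\<close> by (simp_all add: P_def Q_def)
    then have "P = 0" using t by algebra
    then show False using nz by (simp add: P_def)
  qed
  then have A: "A = - cos (rad a)" by (simp add: A_def)
  define K M where "K = cos (rad c) - sin (rad c) * sin (rad (2 * of_int b))" and "M = sin (rad c) * cos (rad (2 * of_int b))"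
  have e1: "sin (rad \<theta>) * K - cos (rad \<theta>) * M = cos (rad a) * (cos (rad \<theta>) * sin (rad c) - sin (rad \<theta>) * cos (rad c))"
    using rel1 by (simp add: K_def M_def algebra_simps)
  have e2: "cos (rad \<theta>) * K + sin (rad \<theta>) * M = cos (rad a) * (cos (rad \<theta>) * cos (rad c) + sin (rad \<theta>) * sin (rad c))"
    using rel2 A by (simp add: K_def M_def algebra_simps)
  have cc: "(sin (rad c))\<^sup>2 + (cos (rad c))\<^sup>2 = 1" and bb: "(sin (rad (2 * of_int b)))\<^sup>2 + (cos (rad (2 * of_int b)))\<^sup>2 = 1"
    by simp_all
  \<comment> \<open>The left sides of \<open>e1\<close> and \<open>e2\<close> are the image of (K,
    M) under an orthogonal map, the right sides cos a times (sin (c - \<theta>), cos (c -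
    \<theta>)); compare squared lengths.\<close>
  have "(cos (rad a))\<^sup>2 = K\<^sup>2 + M\<^sup>2"
  proof -
    have "K\<^sup>2 + M\<^sup>2 = (sin (rad \<theta>) * K - cos (rad \<theta>) * M)\<^sup>2 + (cos (rad \<theta>) * K + sin (rad \<theta>) * M)\<^sup>2"
      using t by algebra
    also have "\<dots> = (cos (rad a))\<^sup>2" unfolding e1 e2 using t cc by algebra
    finally show ?thesis by simp
  qed
  also have "\<dots> = 1 - 2 * sin (rad c) * cos (rad c) * sin (rad (2 * of_int b))"
    unfolding K_def M_def using cc bb by algebra
  finally show "(cos (rad a))\<^sup>2 = 1 - sin (rad (2 * of_int b)) * sin (rad (2 * of_int c))"
    by (simp only: rad_simps(4)[of "of_int c"] sin_double) (simp add: mult_ac)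
qed

section \<open>Integral solutions of sin^2 a = sin 2b sin 2c\<close>

lemma cos_rad_eq_0: "cos (rad x) = 0 \<longleftrightarrow> (\<exists>n::int. odd n \<and> x = 90 * of_int n)"
  by (auto simp: cos_zero_iff_int rad_def field_simps)

lemma cos_rad_neg:
  assumes "90 < n mod 360" "n mod 360 < (270 :: int)"
  shows "cos (rad (of_int n)) < 0"
proof -
  define m where "m = n mod 360 - 180"
  have "real_of_int n = real_of_int (n mod 360) + 360 * real_of_int (n div 360)"
    by (metis mod_mult_div_eq of_int_add of_int_mult of_int_numeral)
  also have "\<dots> = (of_int m + 180 * of_int 1) + 360 * of_int (n div 360)"
    by (simp add: m_def)
  finally have "cos (rad (of_int n)) = - cos (rad (of_int m))"
    by (simp only: cos_rad_add_360 cos_rad_add_180) simp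
  moreover have "cos (rad (of_int m)) > 0"
  proof (rule cos_gt_zero_pi)
    have "rad (- 90) < rad (of_int m)" "rad (of_int m) < rad 90"
      using assms unfolding rad_less_iff m_def by linarith+
    then show "- (pi / 2) < rad (of_int m)" "rad (of_int m) < pi / 2"
      by (simp_all add: rad_def)
  qed
  ultimately show ?thesis by simp
qed

lemma rad_inject: "rad x = rad y \<longleftrightarrow> x = y"
  by (simp add: rad_def)

lemma cos_rad_eq_cos_rad:
  assumes "cos (rad (of_int x)) = cos (rad (of_int y))"
  shows "\<exists>n::int. x = y + 360 * n \<or> x = - y + 360 * n"
proof -
  obtain n where "n \<in> \<int>" and n: "rad (of_int x) = rad (of_int y) + 2 * n * pi \<or> rad (of_int x) = - rad (of_int y) + 2 * n * pi"
    using assms by (auto simp: cos_eq)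
  then obtain m :: int where m: "n = of_int m" by (auto elim: Ints_cases)
  have "real_of_int x = of_int (y + 360 * m) \<or> real_of_int x = of_int (- y + 360 * m)"
  proof -
    have "rad (of_int y) + 2 * n * pi = rad (of_int (y + 360 * m))"
      "- rad (of_int y) + 2 * n * pi = rad (of_int (- y + 360 * m))"
      by (simp_all add: m rad_def ring_distribs add_divide_distrib diff_divide_distrib)
    then show ?thesis using n by (simp only: rad_inject)
  qed
  then show ?thesis by (simp only: of_int_eq_iff) blast
qed

text \<open>The multipliers are prime to 360 and move 2x into the range where the cosine is
  negative. The exceptions are genuine: conjugates of cos 60 are all 1/2, those of cos 90 all
  0.\<close>

lemma negative_conjugate_exists:
  "\<forall>x\<in>{1..66::int}. x \<noteq> 30 \<longrightarrow> x \<noteq> 45 \<longrightarrow>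
     (\<exists>k\<in>{1, 7, 17, 37, 49}. 90 < (2 * k * x) mod 360 \<and> (2 * k * x) mod 360 < 270)"
  by code_simp

lemma sine_product_solution:
  fixes a b c :: int
  assumes eq: "(cos (rad a))\<^sup>2 = 1 - sin (rad (2 * of_int b)) * sin (rad (2 * of_int c))"
    and "odd a" "0 < a" "0 < c" "c < b" "2 * b + a < 180"
  shows "a = 45 \<and> b = 45 \<and> c = 15"
proof -
  \<comment> \<open>Product-to-sum: 2 sin 2b sin 2c = cos 2x - cos 2y.\<close>
  define x y where "x = b - c" and "y = b + c"
  have conj: "1 = cos (rad (2 * real k * real_of_int a)) + cos (rad (2 * real k * real_of_int x)) -
      cos (rad (2 * real k * real_of_int y))"
    if "coprime k 360" "k > 0" for k :: nat
  proof -
    \<comment> \<open>The constant 1 enters as cos 0.\<close>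
    define xs :: "(int \<times> real) list" where "xs = [(-1, 0), (1, 2 * a), (1, 2 * x), (-1, 2 * y)]"
    have "(\<Sum>(m, t)\<leftarrow>xs. of_int m * cos (rad (of_nat k * t))) = 0"
    proof (rule cos_rad_conjugate[where q = 1])
      show "coprime k (360 * 1)" using that by simp
      show "(\<Sum>(m, t)\<leftarrow>xs. of_int m * cos (rad t)) = 0"
      proof -
        have "cos (rad (2 * a)) = 2 * (cos (rad a))\<^sup>2 - 1"
          using cos_double_cos[of "rad a"] by (simp add: rad_simps(4))
        moreover have "2 * real_of_int x = 2 * of_int b - 2 * of_int c" "2 * real_of_int y = 2 * of_int b + 2 * of_int c"
          by (simp_all add: x_def y_def)
        then have "cos (rad (2 * x)) - cos (rad (2 * y)) = 2 * (sin (rad (2 * of_int b)) * sin (rad (2 * of_int c)))"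
          by (simp add: rad_simps(1,2) cos_add cos_diff)
        ultimately show ?thesis using eq by (simp add: xs_def rad_simps(5))
      qed
    qed (use that in \<open>auto simp: xs_def\<close>)
    then show ?thesis by (simp add: xs_def rad_simps(5) mult_ac)
  qed
  have base: "1 = cos (rad (2 * a)) + cos (rad (2 * x)) - cos (rad (2 * y))"
    using conj[of 1] by simp
  have sgn: "cos (rad (2 * 91 * of_int n)) = (if even n then cos (rad (2 * n)) else - cos (rad (2 * n)))" for n :: int
    using cos_rad_add_180[of "2 * n" n] by (simp add: algebra_simps)
  have "coprime (91::nat) 360" by code_simp
  from conj[OF this] have tw: "1 = cos (rad (2 * 91 * of_int a)) + cos (rad (2 * 91 * of_int x)) - cos (rad (2 * 91 * of_int y))"
    by simp
  have par: "even y \<longleftrightarrow> even x" by (simp add: x_def y_def)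
  \<comment> \<open>If x and y were odd, the multiplier 91 would negate all three cosines and give 1
    = -1. With x and y even it negates cos 2a alone, which must therefore vanish.\<close>
  have "even x"
    using base tw unfolding sgn using \<open>odd a\<close> par by (auto split: if_splits)
  then have "cos (rad (2 * a)) = 0"
    using base tw unfolding sgn using \<open>odd a\<close> par by simp
  then obtain l :: int where "odd l" "real_of_int (2 * a) = of_int (90 * l)"
    by (auto simp: cos_rad_eq_0)
  then have "2 * a = 90 * l" by (simp only: of_int_eq_iff)
  then have l: "odd l" "a = 45 * l" using \<open>odd l\<close> by simp_all
  \<comment> \<open>From a \<ge> 45 follows 2b < 135, so b \<le> 67, while c \<ge> 1.\<close>
  have xb: "1 \<le> x" "x \<le> 66" using assms(3-6) l by (auto simp: x_def)
  have "cos (rad (of_int (2 * int k * x))) \<ge> 0" if "coprime k 360" "k > 0" for k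
  proof -
    have "odd k" using that(1) by auto
    then have "cos (rad (2 * real k * real_of_int a)) = 0"
      unfolding cos_rad_eq_0 l using l(1) by (intro exI[of _ "int k * l"]) simp
    \<comment> \<open>The conjugate relation now reads cos 2kx = 1 + cos 2ky.\<close>
    then have "cos (rad (2 * real k * real_of_int x)) \<ge> 0"
      using conj[OF that] cos_ge_minus_one[of "rad (2 * real k * real_of_int y)"] by linarith
    then show ?thesis by simp
  qed
  then have nonneg: "\<not> (90 < (2 * int k * x) mod 360 \<and> (2 * int k * x) mod 360 < 270)" if "coprime k 360" "k > 0" for k
    using cos_rad_neg[of "2 * int k * x"] that by (meson not_le)
  have "coprime (1::nat) 360" "coprime (7::nat) 360" "coprime (17::nat) 360" "coprime (37::nat) 360" "coprime (49::nat) 360"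
    by code_simp+
  then have "\<not> (\<exists>k\<in>{1, 7, 17, 37, 49}. 90 < (2 * k * x) mod 360 \<and> (2 * k * x) mod 360 < 270)"
    using nonneg[of 1] nonneg[of 7] nonneg[of 17] nonneg[of 37] nonneg[of 49] by simp
  then have "x = 30 \<or> x = 45" using negative_conjugate_exists xb by (meson atLeastAtMost_iff)
  then have "x = 30" using \<open>even x\<close> by auto
  \<comment> \<open>With x = 30 the relation becomes 1 = 1/2 - cos 2y.\<close>
  then have "cos (rad (of_int (2 * y))) = - cos (rad 60)"
    using base \<open>cos (rad (2 * a)) = 0\<close> by (simp add: rad_def cos_60)
  also have "\<dots> = cos (rad (of_int 120))"
    by (simp add: rad_def cos_60 cos_120)
  finally obtain n where n: "2 * y = 120 + 360 * n \<or> 2 * y = - 120 + 360 * n"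
    using cos_rad_eq_cos_rad by blast
  have "a = 45 * l" "l > 0" "odd l" "b = c + 30" "y = 2 * c + 30"
    using l assms(3) \<open>x = 30\<close> by (auto simp: x_def y_def)
  moreover have "l < 3" using calculation assms(4,6) by linarith
  then have "l = 1" using \<open>l > 0\<close> \<open>odd l\<close> by (cases "l = 2") auto
  ultimately have y: "a = 45" "b = c + 30" "y = 2 * c + 30" "60 < 2 * y" "2 * y < 210"
    using assms(4,6) by simp_all
  \<comment> \<open>Between 60 and 210 the only angle with cosine -1/2 is 120, whence y = 60 and c =
    15.\<close>
  from n have "2 * y = 120 + 360 * n"
  proof
    assume "2 * y = - 120 + 360 * n"
    with y(4,5) have "0 < n" "n < 1" by linarith+
    then show ?thesis by simp
  qed
  moreover from this y(4,5) have "- 1 < n" "n < 1" by linarith+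
  then have "n = 0" by simp
  ultimately show ?thesis using y(1-3) by simp
qed

section \<open>The exceptional angle\<close>

text \<open>Here cos 2b = 0, sin 2b = 1 and cos 15 - sin 15 = r, so the formula for tan \<theta>
  reduces to sin 15 / (1 + cos 15), the half-angle formula for tan (15/2).\<close>

lemma angle_relation_45_45_15: "angle_relation (15 / 2) 45 45 15"
proof -
  define s t r where "s = sin (rad (15 / 2))" and "t = cos (rad (15 / 2))" and "r = sqrt 2 / 2"
  have st: "s\<^sup>2 + t\<^sup>2 = 1" by (simp add: s_def t_def)
  have d: "rad 15 = 2 * rad (15 / 2)" using rad_simps(4)[of "15 / 2"] by simp
  have s15: "sin (rad 15) = 2 * s * t" unfolding d sin_double s_def t_def by simp
  have c15: "cos (rad 15) = t\<^sup>2 - s\<^sup>2" unfolding d cos_double s_def t_def by simp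
  have v: "cos (rad 45) = r" "sin (rad 45) = r" "cos (rad (2 * 45)) = 0" "sin (rad (2 * 45)) = 1"
    by (simp_all add: rad_def r_def cos_45 sin_45)
  have r2: "r\<^sup>2 = 1 / 2" by (simp add: r_def power_divide)
  have "rad 15 = rad 45 - rad 30" by (simp add: rad_def)
  then have "cos (rad 15) = r * cos (rad 30) + r * sin (rad 30)" "sin (rad 15) = r * cos (rad 30) - r * sin (rad 30)"
    by (simp_all add: cos_diff sin_diff v)
  moreover have "sin (rad 30) = 1 / 2" by (simp add: rad_def sin_30)
  ultimately have diff: "cos (rad 15) - sin (rad 15) = r" by simp
  have "cos (rad 15) * (1 + r) - sin (rad 15) = r * (1 + cos (rad 15))"
    using diff by (simp add: algebra_simps)
  also have "1 + cos (rad 15) = 2 * t\<^sup>2" using st by (simp add: c15)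
  finally have "s * (cos (rad 15) * (1 + r) - sin (rad 15)) = t * (sin (rad 15) * r)"
    by (simp add: s15 power2_eq_square)
  then show ?thesis
    unfolding angle_relation_def v by (simp add: s_def t_def)
qed

lemma angle_relation_unique_45_45_15:
  assumes "angle_relation \<theta> 45 45 15" "0 < \<theta>" "\<theta> < 180"
  shows "\<theta> = 15 / 2"
proof -
  have "sin (rad 15) > 0" by (intro sin_gt_zero) (auto simp: rad_def)
  then have "sin (rad 15) * (cos (rad (2 * 45)) + cos (rad 45)) \<noteq> 0"
    by (simp add: rad_def cos_45)
  from angle_relation_determines[OF assms(1) angle_relation_45_45_15 this]
  obtain n :: int where n: "\<theta> - 15 / 2 = 180 * of_int n" by (auto simp: sin_rad_eq_0)
  with assms(2,3) have "real_of_int n < 1" "real_of_int n > -1" by linarith+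
  then have "n = 0" by linarith
  then show ?thesis using n by simp
qed

section \<open>The geometric configuration\<close>

text \<open>The signed area of the parallelogram on u and v; it supplies sines as the inner product
  supplies cosines.\<close>

definition cross2 :: "real^2 \<Rightarrow> real^2 \<Rightarrow> real" where
  "cross2 u v = u $ 1 * v $ 2 - u $ 2 * v $ 1"

lemma cross2_inner: "(cross2 u v)\<^sup>2 + (u \<bullet> v)\<^sup>2 = (norm u * norm v)\<^sup>2"
  unfolding power_mult_distrib power2_norm_eq_inner
  by (simp add: cross2_def inner_vec_def sum_2 power2_eq_square algebra_simps)

text \<open>Makes sine and cosine of an angle polynomial in coordinates up to the factor r. A
  nonzero cross product excludes coinciding points, so the default value 90 of
  \<open>angle_deg\<close> does not interfere; the absolute value reflects that angles are
  unsigned.\<close>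

lemma angle_deg_polar:
  assumes "cross2 (X - Y) (Z - Y) \<noteq> 0"
  defines "r \<equiv> norm (X - Y) * norm (Z - Y)"
  shows "r > 0"
    and "r * cos (rad (angle_deg X Y Z)) = (X - Y) \<bullet> (Z - Y)"
    and "r * sin (rad (angle_deg X Y Z)) = \<bar>cross2 (X - Y) (Z - Y)\<bar>"
    and "0 < angle_deg X Y Z" "angle_deg X Y Z < 180"
proof -
  define g where "g = (X - Y) \<bullet> (Z - Y)"
  define k where "k = cross2 (X - Y) (Z - Y)"
  have sq: "k\<^sup>2 + g\<^sup>2 = r\<^sup>2" unfolding r_def g_def k_def by (rule cross2_inner)
  have "r \<ge> 0" by (simp add: r_def)
  moreover have "r \<noteq> 0" using sq assms by (auto simp: k_def sum_power2_eq_zero_iff)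
  ultimately show r: "r > 0" by simp
  have "\<bar>g\<bar>\<^sup>2 < r\<^sup>2" using assms(1) by (simp add: k_def flip: sq)
  then have "\<bar>g\<bar> < r" using r by (intro power_less_imp_less_base[of "\<bar>g\<bar>" 2 r]) auto
  then have b: "-1 < g / r" "g / r < 1" using r by (auto simp: field_simps)
  have rad: "rad (angle_deg X Y Z) = arccos (g / r)"
    by (simp add: rad_def angle_deg_def g_def r_def)
  have "0 < arccos (g / r)" "arccos (g / r) < pi" using b arccos_lt_bounded[of "g / r"] by auto
  then show "0 < angle_deg X Y Z" "angle_deg X Y Z < 180"
    unfolding rad[symmetric] by (auto simp: rad_def field_simps zero_less_mult_iff)
  show "r * cos (rad (angle_deg X Y Z)) = (X - Y) \<bullet> (Z - Y)"
    using b r unfolding rad by (simp add: g_def)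
  have "r * sin (arccos (g / r)) = \<bar>k\<bar>"
  proof -
    have "r * sin (arccos (g / r)) = sqrt (r\<^sup>2 * (1 - (g / r)\<^sup>2))"
      using b r by (simp add: sin_arccos real_sqrt_mult)
    also have "r\<^sup>2 * (1 - (g / r)\<^sup>2) = k\<^sup>2"
      using r sq by (simp add: right_diff_distrib power_divide)
    finally show ?thesis by simp
  qed
  then show "r * sin (rad (angle_deg X Y Z)) = \<bar>cross2 (X - Y) (Z - Y)\<bar>"
    unfolding rad k_def .
qed

lemma collinear_cross2:
  assumes "cross2 (B - A) (C - A) = 0"
  shows "collinear {A, B, C}"
proof -
  have "collinear {0, C - A, B - A}"
  proof (cases "C - A = 0")
    case False
    define u v where "u = B - A" and "v = C - A"
    have "v $ 1 * v $ 1 + v $ 2 * v $ 2 \<noteq> 0"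
      using False by (auto simp: v_def[symmetric] vec_eq_iff forall_2 sum_squares_eq_zero_iff)
    moreover have "u $ 1 * v $ 2 = u $ 2 * v $ 1"
      using assms by (simp add: cross2_def u_def v_def)
    then have "u $ 1 * (v $ 1 * v $ 1 + v $ 2 * v $ 2) = (u \<bullet> v) * v $ 1"
      "u $ 2 * (v $ 1 * v $ 1 + v $ 2 * v $ 2) = (u \<bullet> v) * v $ 2"
      by (simp_all add: inner_vec_def sum_2) algebra+
    \<comment> \<open>A vanishing cross product makes u equal to its projection onto v.\<close>
    ultimately have "u = ((u \<bullet> v) / (v $ 1 * v $ 1 + v $ 2 * v $ 2)) *\<^sub>R v"
      by (simp add: vec_eq_iff forall_2 eq_divide_eq)
    then show ?thesis unfolding u_def v_def collinear_lemma by blast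
  qed (simp add: collinear_lemma)
  then have "collinear {C, A, B}" by (subst collinear_3) auto
  then show ?thesis by (simp add: insert_commute)
qed

text \<open>All vectors are combinations of u = B - A and v = C - A, which have the same squared
  length L. Scaled sines and cosines thus become polynomials in L, s, t and x = cos a, y = sin a,
  and every claim is checked there.\<close>

lemma configuration_angle_relation:
  fixes A B C D E :: "real^2"
  defines "a \<equiv> angle_deg B A C" and "b \<equiv> angle_deg D B C" and "c \<equiv> angle_deg E C B"
    and "\<theta> \<equiv> angle_deg E D B"
  assumes "\<not> collinear {A, B, C}" "dist A B = dist A C" "D \<in> open_segment A C" "E \<in> open_segment A B"
  shows "angle_relation \<theta> a b c" "0 < a" "0 < b" "0 < c" "2 * b + a < 180" "0 < \<theta>" "\<theta> < 180"
proof -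
  define u v where "u = B - A" and "v = C - A"
  define L g k where "L = u \<bullet> u" and "g = u \<bullet> v" and "k = \<bar>cross2 u v\<bar>"
  have k0: "cross2 u v \<noteq> 0" using collinear_cross2 assms(5) by (auto simp: u_def v_def)
  have Lv: "v \<bullet> v = L" using assms(6) by (simp add: L_def u_def v_def dot_square_norm dist_norm norm_minus_commute)
  obtain t where t: "0 < t" "t < 1" "D - A = t *\<^sub>R v"
    using assms(7) by (auto simp: in_segment v_def algebra_simps)
  obtain s where s: "0 < s" "s < 1" "E - A = s *\<^sub>R u"
    using assms(8) by (auto simp: in_segment u_def algebra_simps)
  have vecs: "D - B = t *\<^sub>R v - u" "C - B = v - u" "E - C = s *\<^sub>R u - v" "B - C = u - v"
    "E - D = s *\<^sub>R u - t *\<^sub>R v" "B - D = u - t *\<^sub>R v"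
  proof -
    have "D = A + t *\<^sub>R v" "E = A + s *\<^sub>R u" "B = A + u" "C = A + v"
      using t(3) s(3) by (simp_all add: diff_eq_eq add.commute u_def v_def)
    then show "D - B = t *\<^sub>R v - u" "C - B = v - u" "E - C = s *\<^sub>R u - v" "B - C = u - v"
      "E - D = s *\<^sub>R u - t *\<^sub>R v" "B - D = u - t *\<^sub>R v" by simp_all
  qed
  have crs: "cross2 (D - B) (C - B) = - ((1 - t) * cross2 u v)" "cross2 (E - C) (B - C) = (1 - s) * cross2 u v"
    "cross2 (E - D) (B - D) = t * (1 - s) * cross2 u v"
    unfolding vecs by (simp_all add: cross2_def algebra_simps)
  have inn: "(D - B) \<bullet> (C - B) = (1 + t) * (L - g)" "(E - C) \<bullet> (B - C) = (1 + s) * (L - g)"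
    "(E - D) \<bullet> (B - D) = s * L + t\<^sup>2 * L - t * (1 + s) * g"
    unfolding vecs using Lv by (simp_all add: L_def g_def inner_diff_left inner_diff_right inner_commute[of v u] power2_eq_square algebra_simps)
  define ra rb rc rt where "ra = norm (B - A) * norm (C - A)" and "rb = norm (D - B) * norm (C - B)"
    and "rc = norm (E - C) * norm (B - C)" and "rt = norm (E - D) * norm (B - D)"
  have ra: "ra > 0" "ra * cos (rad a) = g" "ra * sin (rad a) = k" "0 < a" "a < 180"
    using angle_deg_polar[of B A C] k0 unfolding a_def g_def k_def u_def v_def ra_def by auto
  have raL: "ra = L"
    using Lv by (simp add: ra_def L_def u_def v_def norm_eq_sqrt_inner)
  have rb: "rb > 0" "rb * cos (rad b) = (1 + t) * (L - g)" "rb * sin (rad b) = (1 - t) * k" "0 < b" "b < 180"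
    using angle_deg_polar[of D B C] k0 t unfolding b_def k_def rb_def inn crs by (auto simp: abs_mult)
  have rc: "rc > 0" "rc * cos (rad c) = (1 + s) * (L - g)" "rc * sin (rad c) = (1 - s) * k" "0 < c" "c < 180"
    using angle_deg_polar[of E C B] k0 s unfolding c_def k_def rc_def inn crs by (auto simp: abs_mult)
  have rt: "rt > 0" "rt * cos (rad \<theta>) = s * L + t\<^sup>2 * L - t * (1 + s) * g"
      "rt * sin (rad \<theta>) = t * (1 - s) * k" "0 < \<theta>" "\<theta> < 180"
    using angle_deg_polar[of E D B] k0 s t unfolding \<theta>_def k_def rt_def inn crs by (auto simp: abs_mult)
  define x y where "x = cos (rad a)" and "y = sin (rad a)"
  have xy: "x\<^sup>2 + y\<^sup>2 = 1" by (simp add: x_def y_def)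
  have gk: "g = L * x" "k = L * y" using ra raL by (simp_all add: x_def y_def)
  have L: "L > 0" using ra raL by simp
  have "k > 0" using k0 by (simp add: k_def)
  then have "y > 0" using gk(2) L by (simp add: zero_less_mult_iff)
  have x1: "x < 1"
  proof -
    have "y\<^sup>2 > 0" using \<open>y > 0\<close> by simp
    then have "x\<^sup>2 < 1" using xy by linarith
    then show ?thesis by (simp add: abs_square_less_1)
  qed
  have dbl: "rb\<^sup>2 * cos (rad (2 * b)) = L\<^sup>2 * ((1 + t)\<^sup>2 * (1 - x)\<^sup>2 - (1 - t)\<^sup>2 * y\<^sup>2)"
       "rb\<^sup>2 * sin (rad (2 * b)) = L\<^sup>2 * (2 * (1 + t) * (1 - t) * (1 - x) * y)"
       "rb\<^sup>2 = L\<^sup>2 * ((1 + t)\<^sup>2 * (1 - x)\<^sup>2 + (1 - t)\<^sup>2 * y\<^sup>2)"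
  proof -
    have "rb\<^sup>2 * cos (rad (2 * b)) = (rb * cos (rad b))\<^sup>2 - (rb * sin (rad b))\<^sup>2"
      by (simp add: rad_simps cos_double power_mult_distrib right_diff_distrib)
    then show "rb\<^sup>2 * cos (rad (2 * b)) = L\<^sup>2 * ((1 + t)\<^sup>2 * (1 - x)\<^sup>2 - (1 - t)\<^sup>2 * y\<^sup>2)"
      unfolding rb gk by (simp add: algebra_simps power2_eq_square)
    have "rb\<^sup>2 * sin (rad (2 * b)) = 2 * (rb * cos (rad b)) * (rb * sin (rad b))"
      by (simp add: rad_simps sin_double power2_eq_square)
    then show "rb\<^sup>2 * sin (rad (2 * b)) = L\<^sup>2 * (2 * (1 + t) * (1 - t) * (1 - x) * y)"
      unfolding rb gk by (simp add: algebra_simps power2_eq_square)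
    have "rb\<^sup>2 = rb\<^sup>2 * ((cos (rad b))\<^sup>2 + (sin (rad b))\<^sup>2)" by simp
    also have "\<dots> = (rb * cos (rad b))\<^sup>2 + (rb * sin (rad b))\<^sup>2"
      by (simp add: power_mult_distrib distrib_left del: sin_cos_squared_add2)
    finally show "rb\<^sup>2 = L\<^sup>2 * ((1 + t)\<^sup>2 * (1 - x)\<^sup>2 + (1 - t)\<^sup>2 * y\<^sup>2)"
      unfolding rb gk by (simp add: algebra_simps power2_eq_square)
  qed
  \<comment> \<open>\<open>dbl(3)\<close> is unfolded last because it rewrites
    \<open>rb\<^sup>2\<close>, which the left side of \<open>dbl(1)\<close> contains. Positivity of
    the result gives cos (180 - a) < cos 2b.\<close>
  have pos: "rb\<^sup>2 * (cos (rad (2 * b)) + x) = L\<^sup>2 * (4 * t * (1 - x) * y\<^sup>2)"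
    unfolding distrib_left[of "rb\<^sup>2"] dbl(1) unfolding dbl(3) using xy by algebra
  moreover have "L\<^sup>2 * (4 * t * (1 - x) * y\<^sup>2) > 0"
    using L t x1 \<open>y > 0\<close> by simp
  ultimately have "rb\<^sup>2 * (cos (rad (2 * b)) + x) > 0" by (simp only:)
  then have "cos (rad (2 * b)) + x > 0"
    using rb(1) by (auto dest: zero_less_mult_pos)
  then have "cos (pi - rad a) < cos (rad (2 * b))" by (simp add: x_def)
  \<comment> \<open>Cosines determine the order of angles only within 0 to 180. An obtuse b would
    have a negative cosine, against (1 + t) (L - g) > 0.\<close>
  moreover have "rad (2 * b) \<le> pi"
  proof (rule ccontr)
    assume "\<not> rad (2 * b) \<le> pi"
    then have "rad b > pi / 2" by (simp add: rad_simps)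
    moreover have "rad b < pi" using rb(5) by (simp add: rad_def)
    ultimately have "cos (rad b) < 0" using cos_monotone_0_pi[of "pi / 2" "rad b"] by simp
    moreover have "L - g = L * (1 - x)" by (simp add: gk right_diff_distrib)
    then have "rb * cos (rad b) > 0"
      using t L x1 by (simp add: rb(2))
    ultimately show False using rb(1) by (simp add: zero_less_mult_iff)
  qed
  ultimately have "rad (2 * b) < pi - rad a"
    using ra(4,5) rb(4) by (subst (asm) cos_mono_less_eq) (auto simp: rad_def)
  moreover have "pi - rad a = rad (180 - a)"
    by (simp add: rad_def left_diff_distrib diff_divide_distrib)
  ultimately show "2 * b + a < 180" by (simp add: rad_less_iff)
  show "angle_relation \<theta> a b c"
  proof -
    \<comment> \<open>The positive factor supplies one norm product for \<theta>, one for c and two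
      for the double angle 2b; what remains is a polynomial identity modulo x^2 + y^2 = 1.\<close>
    have "(rt * rc * rb\<^sup>2) * (sin (rad \<theta>) * (cos (rad c) * (1 + x) - sin (rad c) * sin (rad (2 * b)))) =
       (rt * sin (rad \<theta>)) * ((rc * cos (rad c)) * (rb\<^sup>2 * (1 + x)) - (rc * sin (rad c)) * (rb\<^sup>2 * sin (rad (2 * b))))"
      by (simp add: algebra_simps)
    also have "\<dots> = (rt * cos (rad \<theta>)) * (rc * sin (rad c)) * (rb\<^sup>2 * (cos (rad (2 * b)) + x))"
      unfolding pos rt rc gk dbl(2) unfolding dbl(3) using xy by algebra
    also have "\<dots> = (rt * rc * rb\<^sup>2) * (cos (rad \<theta>) * (sin (rad c) * (cos (rad (2 * b)) + x)))"
      by (simp add: algebra_simps)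
    finally show ?thesis
      using rt(1) rc(1) rb(1) unfolding angle_relation_def x_def by simp
  qed
  show "0 < a" "0 < b" "0 < c" "0 < \<theta>" "\<theta> < 180"
    by (fact ra rb rc rt)+
qed

section \<open>Nondegeneracy and conclusion\<close>

text \<open>From 0 < 2b < 180 - a follows cos 2b > - cos a, so the numerator of tan \<theta> is
  nonzero and the relation determines \<theta> modulo 180.\<close>

lemma angle_relation_nondegenerate:
  assumes "0 < a" "0 < c" "c < b" "2 * b + a < 180"
  shows "sin (rad c) * (cos (rad (2 * b)) + cos (rad a)) \<noteq> 0"
proof -
  have "rad 0 < rad c" "rad c < rad 180" using assms unfolding rad_less_iff by linarith+
  then have "sin (rad c) > 0" by (intro sin_gt_zero) (simp_all add: rad_def)
  moreover have "rad 0 < rad (2 * b)" "rad (2 * b) < rad (180 - a)" "rad 0 < rad a"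
    using assms unfolding rad_less_iff by linarith+
  then have "cos (rad (180 - a)) < cos (rad (2 * b))"
    by (intro cos_monotone_0_pi) (simp_all add: rad_simps(2,5), simp add: rad_def)
  moreover have "cos (rad (180 - a)) = - cos (rad a)"
    by (simp add: rad_simps(2)) (simp add: rad_def)
  ultimately show ?thesis by simp
qed

theorem theorem2:
  fixes A B C D E :: "real^2" and a b c \<theta> :: real
  assumes "\<not> collinear {A, B, C}"
    and "dist A B = dist A C"
    and "D \<in> open_segment A C"
    and "E \<in> open_segment A B"
    and "a = angle_deg B A C"
    and "b = angle_deg D B C"
    and "c = angle_deg E C B"
    and "\<theta> = angle_deg E D B"
    and "a \<in> \<int>" and "b \<in> \<int>" and "c \<in> \<int>"
    and "b > c"
  shows "(\<theta> \<in> \<rat> \<and> \<theta> \<notin> \<int> \<longleftrightarrow> (a, b, c) = (45, 45, 15)) \<and>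
         ((a, b, c) = (45, 45, 15) \<longrightarrow> \<theta> = 15 / 2)"
proof -
  note rel = configuration_angle_relation[OF assms(1-4), folded assms(5-8)]
  obtain i j k :: int where ijk: "a = of_int i" "b = of_int j" "c = of_int k"
    using assms(9-11) by (auto elim!: Ints_cases)
  have fwd: "a = 45 \<and> b = 45 \<and> c = 15" if "\<theta> \<in> \<rat>" "\<theta> \<notin> \<int>"
  proof -
    have nz: "sin (rad (of_int k)) * (cos (rad (2 * of_int j)) + cos (rad (of_int i))) \<noteq> 0"
      using angle_relation_nondegenerate[OF rel(2,4) assms(12) rel(5)] by (simp add: ijk)
    note rel' = rel(1)[unfolded ijk]
    have "2 * \<theta> \<in> \<int>" by (rule angle_relation_half_integer[OF rel' that(1) nz])
    note half = angle_relation_proper_half[OF rel' this that(2) nz]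
    have "2 * j + i < 180" using rel(5) unfolding ijk by linarith
    then have "i = 45 \<and> j = 45 \<and> k = 15"
      using sine_product_solution[OF half(2,1)] rel(2,4) assms(12) by (simp add: ijk)
    then show ?thesis by (simp add: ijk)
  qed
  \<comment> \<open>The relation fixes \<theta> modulo 180, and the geometry places it strictly
    between 0 and 180.\<close>
  have angle: "\<theta> = 15 / 2" if "a = 45 \<and> b = 45 \<and> c = 15"
    using angle_relation_unique_45_45_15 rel(1,6,7) that by blast
  have "(15 / 2 :: real) \<in> \<rat>" by (intro Rats_divide) auto
  moreover have "(15 / 2 :: real) \<notin> \<int>"
  proof
    assume "(15 / 2 :: real) \<in> \<int>"
    then obtain n :: int where "15 / 2 = (of_int n :: real)" by (elim Ints_cases)
    then have "real_of_int (2 * n) = of_int 15" by simp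
    then have "2 * n = 15" by (simp only: of_int_eq_iff)
    then show False by presburger
  qed
  ultimately have bwd: "\<theta> \<in> \<rat> \<and> \<theta> \<notin> \<int>" if "a = 45 \<and> b = 45 \<and> c = 15"
    unfolding angle[OF that] by blast
  show ?thesis unfolding prod.inject using fwd angle bwd by blast
qed

end
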